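(* Let $T$ be a finite nonempty set of integers, all $>1$, and $M=\max_{t\in T}(t-1)$. Let $B$ be the $2^M\times2^M$ signed de Bruijn matrix and $\mathcal R(f)$ the rules matrix attached to $T$ (defined in the context). Then, up to a simultaneous permutation of rows and columns, $$\mathcal R(f)=\begin{pmatrix}B^T&0\\ c&2\end{pmatrix}$$ for some row vector $c$ (where $B^T$ is the transpose of $B$). Consequently $$\det(xI-\mathcal R(f))=(x-2)\det(xI-B).$$ In particular, the roots $\eta_1,\dots,\eta_{2^M}$ of $\det(xI-\mathcal R(f))$ remaining after removing one occurrence of the distinguished root $2$, counted with algebraic multiplicity, are precisely the eigenvalues of $B$, counted with algebraic multiplicity.
   Context: For $a=(a_0,\dots,a_{M-1})\in\mathbb F_2^M$ and $\varepsilon\in\mathbb F_2$ put $\sigma_\varepsilon(a)=(a_1,\dots,a_{M-1},\varepsilon)$. $B$ is the matrix indexed by $\mathbb F_2^M$ with $B_{a,b}=(-1)^{\varepsilon\sum_{t\in T}a_{M-t+1}}$ if $b=\sigma_\varepsilon(a)$, $\varepsilon\in\mathbb F_2$, and $B_{a,b}=0$ otherwise. Definition of the rules matrix. Let $\mathcal S=\prod_{t\in T}\mathbb F_2^{t-1}$. Write $u\in\mathcal S$ as $u=(u^{(t)})_{t\in T}$ with $u^{(t)}=(u^{(t)}_0,\dots,u^{(t)}_{t-2})$. For $\varepsilon\in\mathbb F_2$ define $\Sigma_\varepsilon(u)\in\mathcal S$ by $\Sigma_\varepsilon(u)^{(t)}=(u^{(t)}_1,\dots,u^{(t)}_{t-2},\varepsilon)$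 for each $t\in T$. Let $W$ be the matrix with rows and columns indexed by $\mathcal S$ (rows are new states, columns are old states) with $W_{\Sigma_\varepsilon(u),u}=(-1)^{\varepsilon\sum_{t\in T}u^{(t)}_0}$ for $\varepsilon\in\mathbb F_2$, $u\in\mathcal S$, and all other entries zero. The expanded rules matrix is obtained from $W$ by adjoining one final row and one final column: the final column is zero except for its last entry (in the final row), which is $2$; the final row has, in the column indexed by $u\in\mathcal S$, the entry $1$ if $\sum_{t\in T}u^{(t)}_0=1$ in $\mathbb F_2$ and $0$ otherwise. The rules matrix $\mathcal R(f)$ is obtained from the expanded rules matrix by repeatedly deleting a zero row together with the column of the same index, until no zero row remains. *)

theory Defs
  imports
    "HOL-Library.Z2"
    "HOL-Combinatorics.Permutations"
    "Jordan_Normal_Form.Char_Poly"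
begin

text \<open>
  The field with two elements is the type \<open>bit\<close>; vectors over it of length \<open>n\<close> are lists of
  length \<open>n\<close>. Matrices with structured indices are functions of two arguments together with
  an index set; \<open>mat_of_enum\<close> turns them into library matrices once the index set is listed.
\<close>

definition bit_words :: "nat \<Rightarrow> bit list set" where
  "bit_words n = {a. length a = n}"

definition bit_sign :: "bit \<Rightarrow> complex" where
  "bit_sign e = (if e = 0 then 1 else - 1)"

definition mat_of_enum :: "('i \<Rightarrow> 'i \<Rightarrow> 'a) \<Rightarrow> 'i list \<Rightarrow> 'a mat" where
  "mat_of_enum A xs = mat (length xs) (length xs) (\<lambda>(i, j). A (xs ! i) (xs ! j))"

definition permuted_mat :: "(nat \<Rightarrow> nat) \<Rightarrow> 'a mat \<Rightarrow> 'a mat" where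
  "permuted_mat p A = mat (dim_row A) (dim_col A) (\<lambda>(i, j). A $$ (p i, p j))"

definition eigenvalue_mset :: "complex mat \<Rightarrow> complex multiset" where
  "eigenvalue_mset A =
     (\<Sum>l \<in> {l. eigenvalue A l}. replicate_mset (order l (char_poly A)) l)"


subsection \<open>The signed de Bruijn matrix\<close>

definition window_length :: "nat set \<Rightarrow> nat" where
  "window_length T = Max ((\<lambda>t. t - 1) ` T)"

definition shift :: "bit \<Rightarrow> bit list \<Rightarrow> bit list" where
  "shift e a = tl a @ [e]"

text \<open>
  The bit \<open>e\<close> in \<open>b = shift e a\<close> is unique, being the last letter of \<open>b\<close>. The subscript
  $M-t+1$ is written \<open>M + 1 - t\<close> because \<open>t = M + 1\<close> occurs and subtraction on \<open>nat\<close> truncates.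
\<close>

definition signed_de_bruijn :: "nat set \<Rightarrow> bit list \<Rightarrow> bit list \<Rightarrow> complex" where
  "signed_de_bruijn T a b =
     (if \<exists>e. b = shift e a
      then bit_sign ((THE e. b = shift e a) * (\<Sum>t\<in>T. a ! (window_length T + 1 - t)))
      else 0)"

definition de_bruijn_matrix :: "nat set \<Rightarrow> bit list list \<Rightarrow> complex mat" where
  "de_bruijn_matrix T ws = mat_of_enum (signed_de_bruijn T) ws"

lemma signed_de_bruijn_shift:
  "signed_de_bruijn T a (shift e a) = bit_sign (e * (\<Sum>t\<in>T. a ! (window_length T + 1 - t)))"
proof -
  have "(THE e'. shift e a = shift e' a) = e"
    by (rule the_equality) (auto simp: shift_def)
  then show ?thesis
    by (auto simp: signed_de_bruijn_def)
qed


subsection \<open>The rules matrix\<close>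

type_synonym rules_state = "nat \<Rightarrow> bit list"

definition rules_states :: "nat set \<Rightarrow> rules_state set" where
  "rules_states T = (\<Pi>\<^sub>E t\<in>T. bit_words (t - 1))"

definition shift_state :: "nat set \<Rightarrow> bit \<Rightarrow> rules_state \<Rightarrow> rules_state" where
  "shift_state T e u = (\<lambda>t\<in>T. shift e (u t))"

definition rules_transition :: "nat set \<Rightarrow> rules_state \<Rightarrow> rules_state \<Rightarrow> complex" where
  "rules_transition T v u =
     (if \<exists>e. v = shift_state T e u
      then bit_sign ((THE e. v = shift_state T e u) * (\<Sum>t\<in>T. u t ! 0))
      else 0)"

lemma rules_transition_shift_state:
  assumes "T \<noteq> {}"
  shows "rules_transition T (shift_state T e u) u = bit_sign (e * (\<Sum>t\<in>T. u t ! 0))"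
proof -
  obtain t where t: "t \<in> T"
    using assms by blast
  have "(THE e'. shift_state T e u = shift_state T e' u) = e"
  proof (rule the_equality)
    fix e' assume "shift_state T e u = shift_state T e' u"
    from fun_cong[OF this, of t] t show "e' = e"
      by (simp add: shift_state_def shift_def)
  qed simp
  then show ?thesis
    by (auto simp: rules_transition_def)
qed

text \<open>The index \<open>None\<close> is that of the adjoined final row and column.\<close>

definition expanded_index :: "nat set \<Rightarrow> rules_state option set" where
  "expanded_index T = insert None (Some ` rules_states T)"

fun expanded_rules :: "nat set \<Rightarrow> rules_state option \<Rightarrow> rules_state option \<Rightarrow> complex" where
  "expanded_rules T (Some v) (Some u) = rules_transition T v u"
| "expanded_rules T (Some v) None = 0"
| "expanded_rules T None (Some u) = (if (\<Sum>t\<in>T. u t ! 0) = 1 then 1 else 0)"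
| "expanded_rules T None None = 2"

text \<open>
  Deleting a zero row and the column of the same index acts on the index set. The row is
  tested on the surviving columns only, so one deletion may create new zero rows.
\<close>

inductive delete_zero_row :: "('i \<Rightarrow> 'i \<Rightarrow> 'a::zero) \<Rightarrow> 'i set \<Rightarrow> 'i set \<Rightarrow> bool"
  for A :: "'i \<Rightarrow> 'i \<Rightarrow> 'a" where
  "i \<in> I \<Longrightarrow> (\<forall>j\<in>I. A i j = 0) \<Longrightarrow> delete_zero_row A I (I - {i})"

definition no_zero_row :: "('i \<Rightarrow> 'i \<Rightarrow> 'a::zero) \<Rightarrow> 'i set \<Rightarrow> bool" where
  "no_zero_row A I \<longleftrightarrow> (\<forall>i\<in>I. \<exists>j\<in>I. A i j \<noteq> 0)"

definition reduced_index :: "('i \<Rightarrow> 'i \<Rightarrow> 'a::zero) \<Rightarrow> 'i set \<Rightarrow> 'i set" where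
  "reduced_index A I = (THE J. (delete_zero_row A)\<^sup>*\<^sup>* I J \<and> no_zero_row A J)"

text \<open>The outcome of the deletions exists and does not depend on the order of the deletions.\<close>

lemma no_zero_row_subset:
  assumes "(delete_zero_row A)\<^sup>*\<^sup>* I J" "no_zero_row A K" "K \<subseteq> I"
  shows "K \<subseteq> J"
  using assms(1,3)
proof (induction rule: rtranclp_induct)
  case base
  then show ?case .
next
  case (step J J')
  then show ?case
    using assms(2) by (auto elim!: delete_zero_row.cases simp: no_zero_row_def) (metis subsetD)
qed

lemma delete_zero_row_subset: "(delete_zero_row A)\<^sup>*\<^sup>* I J \<Longrightarrow> J \<subseteq> I"
  by (induction rule: rtranclp_induct) (auto elim: delete_zero_row.cases)

lemma ex_reduced_index:
  assumes "finite I"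
  shows "\<exists>J. (delete_zero_row A)\<^sup>*\<^sup>* I J \<and> no_zero_row A J"
  using assms
proof (induction "card I" arbitrary: I rule: less_induct)
  case less
  show ?case
  proof (cases "no_zero_row A I")
    case True
    then show ?thesis by blast
  next
    case False
    then obtain i where i: "i \<in> I" "\<forall>j\<in>I. A i j = 0"
      by (auto simp: no_zero_row_def)
    then have "card (I - {i}) < card I"
      using less.prems by (intro card_Diff1_less)
    then obtain J where "(delete_zero_row A)\<^sup>*\<^sup>* (I - {i}) J" "no_zero_row A J"
      using less.hyps[of "I - {i}"] less.prems by blast
    then show ?thesis
      using delete_zero_row.intros[of i I A] i by (meson converse_rtranclp_into_rtranclp)
  qed
qed

lemma ex1_reduced_index:
  assumes "finite I"
  shows "\<exists>!J. (delete_zero_row A)\<^sup>*\<^sup>* I J \<and> no_zero_row A J"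
  using ex_reduced_index[OF assms, of A]
  by (metis delete_zero_row_subset no_zero_row_subset subset_antisym)

lemma finite_expanded_index:
  assumes "finite T"
  shows "finite (expanded_index T)"
proof -
  have "finite (bit_words n)" for n
  proof -
    have "finite (UNIV :: bit set)"
      by (rule finite_subset[of _ "{0, 1}"]) auto
    then show ?thesis
      using finite_lists_length_eq[of UNIV n] by (simp add: bit_words_def)
  qed
  then show ?thesis
    using assms by (simp add: expanded_index_def rules_states_def finite_PiE)
qed

definition rules_index :: "nat set \<Rightarrow> rules_state option set" where
  "rules_index T = reduced_index (expanded_rules T) (expanded_index T)"

definition rules_matrix :: "nat set \<Rightarrow> rules_state option list \<Rightarrow> complex mat" where
  "rules_matrix T us = mat_of_enum (expanded_rules T) us"

lemma rules_index_reduced: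
  assumes "finite T"
  shows "(delete_zero_row (expanded_rules T))\<^sup>*\<^sup>* (expanded_index T) (rules_index T)"
    and "no_zero_row (expanded_rules T) (rules_index T)"
  using theI'[OF ex1_reduced_index[OF finite_expanded_index[OF assms], of "expanded_rules T"]]
  by (simp_all add: rules_index_def reduced_index_def)

end

theory Submission
  imports Defs
begin

text \<open>
  A state surviving the deletions has a surviving predecessor, hence a surviving ancestor \<open>M\<close>
  steps back. The component for \<open>t\<close> has length at most \<open>M\<close>, so after \<open>M\<close> steps it consists of
  the last \<open>t - 1\<close> inputs alone. The surviving states are thus parametrised by the input words
  of length \<open>M\<close>; the parametrisation is injective because \<open>t - 1 = M\<close> for some \<open>t\<close>, and it
  carries the transitions of states to the shifts of words. Rows of the rules matrix are new
  states while rows of \<open>B\<close> are old words, which accounts for the transpose.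
\<close>

section \<open>Counting words; determinants and characteristic polynomials\<close>

lemma UNIV_bit: "(UNIV :: bit set) = {0, 1}"
  by auto

lemma card_bit_words: "card (bit_words n) = 2 ^ n"
proof -
  have "bit_words n = {xs. set xs \<subseteq> (UNIV :: bit set) \<and> length xs = n}"
    by (simp add: bit_words_def)
  then show ?thesis
    using card_lists_length_eq[of "UNIV :: bit set" n] by (simp add: UNIV_bit numeral_2_eq_2)
qed

lemma bit_sign_nonzero [simp]: "bit_sign e \<noteq> 0"
  by (simp add: bit_sign_def)

lemma mat_of_enum_carrier: "mat_of_enum A xs \<in> carrier_mat (length xs) (length xs)"
  by (simp add: mat_of_enum_def)

text \<open>Permuting columns is permuting the rows of the transpose, so the sign of
  \<open>p\<close> enters twice and cancels.\<close>

lemma det_simultaneous_permutation: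
  fixes A :: "'a :: comm_ring_1 mat"
  assumes A: "A \<in> carrier_mat n n" and p: "p permutes {0..<n}"
  shows "det (mat n n (\<lambda>(i, j). A $$ (p i, p j))) = det A"
proof -
  let ?B = "mat n n (\<lambda>(i, j). A $$ (p i, j))"
  have p_less: "p i < n" if "i < n" for i
    using permutes_in_image[OF p, of i] that by simp
  have "det (mat n n (\<lambda>(i, j). A $$ (p i, p j))) = det (mat n n (\<lambda>(i, j). ?B\<^sup>T $$ (p i, j)))"
    by (subst det_transpose[symmetric, of _ n], simp, rule arg_cong[of _ _ det])
      (auto simp: p_less)
  also have "\<dots> = signof p * det ?B"
    by (subst det_permute_rows[OF _ p]) (simp_all add: det_transpose[of _ n])
  also have "\<dots> = signof p * (signof p * det A)"
    by (subst det_permute_rows[OF A p]) simp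
  also have "\<dots> = det A"
    by (simp add: sign_def)
  finally show ?thesis .
qed

text \<open>As \<open>p\<close> is injective, it carries diagonal positions, and only those, to
  diagonal positions; hence permuting commutes with forming the characteristic matrix.\<close>

lemma char_poly_permuted_mat:
  fixes A :: "'a :: comm_ring_1 mat"
  assumes A: "A \<in> carrier_mat n n" and p: "p permutes {..<n}"
  shows "char_poly (permuted_mat p A) = char_poly A"
proof -
  have p': "p permutes {0..<n}"
    using p by (simp add: atLeast0LessThan)
  have p_less: "p i < n" if "i < n" for i
    using permutes_in_image[OF p, of i] that by simp
  have p_eq: "p i = p j \<longleftrightarrow> i = j" for i j
    using permutes_inj[OF p] by (auto dest: injD)
  have "char_poly_matrix (permuted_mat p A)
      = mat n n (\<lambda>(i, j). char_poly_matrix A $$ (p i, p j))"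
    using A by (auto simp: char_poly_matrix_def permuted_mat_def p_less p_eq)
  then show ?thesis
    using det_simultaneous_permutation[OF char_poly_matrix_closed[OF A] p']
    by (simp add: char_poly_def)
qed

lemma char_poly_upper_right_zero_col:
  fixes A :: "'a :: idom mat"
  assumes A: "A \<in> carrier_mat n n" and c: "c \<in> carrier_mat 1 n" and d: "D \<in> carrier_mat 1 1"
  shows "char_poly (four_block_mat A (0\<^sub>m n 1) c D) = char_poly A * char_poly D"
proof -
  have "char_poly_matrix (four_block_mat A (0\<^sub>m n 1) c D)
      = four_block_mat (char_poly_matrix A) (0\<^sub>m n 1) (map_mat (\<lambda>a. [:- a:]) c) (char_poly_matrix D)"
    using assms by (auto simp: char_poly_matrix_def)
  then show ?thesis
    unfolding char_poly_def
    using det_four_block_mat_upper_right_zero_col[OF char_poly_matrix_closed[OF A] refl _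
        char_poly_matrix_closed[OF d], of "map_mat (\<lambda>a. [:- a:]) c"] c
    by simp
qed

text \<open>Eigenvalues are the roots of the characteristic polynomial, and both multisets count a
  root by its order.\<close>

lemma eigenvalue_mset_eq_proots:
  assumes A: "A \<in> carrier_mat n n"
  shows "eigenvalue_mset A = proots (char_poly A)"
proof (rule multiset_eqI)
  fix x
  have nz: "char_poly A \<noteq> 0"
    using degree_monic_char_poly[OF A] by auto
  have ev: "{l. eigenvalue A l} = {l. poly (char_poly A) l = 0}"
    using eigenvalue_root_char_poly[OF A] by simp
  have fin: "finite {l. poly (char_poly A) l = 0}"
    using nz by (rule poly_roots_finite)
  show "count (eigenvalue_mset A) x = count (proots (char_poly A)) x"
    using nz fin by (auto simp: eigenvalue_mset_def ev count_sum order_0I)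
qed

section \<open>Words and the states they produce\<close>

text \<open>The state that any state reaches after the \<open>M\<close> successive inputs \<open>a\<close>.\<close>

definition suffix_state :: "nat set \<Rightarrow> bit list \<Rightarrow> rules_state" where
  "suffix_state T a = (\<lambda>t\<in>T. drop (window_length T - (t - 1)) a)"

lemma window_length_ge:
  assumes "finite T" "t \<in> T"
  shows "t - 1 \<le> window_length T"
  using assms by (auto simp: window_length_def)

lemma window_length_attained:
  assumes "finite T" "T \<noteq> {}"
  obtains t where "t \<in> T" "t - 1 = window_length T"
proof -
  have "window_length T \<in> (\<lambda>t. t - 1) ` T"
    using assms unfolding window_length_def by (intro Max_in) auto
  then show thesis
    using that by auto
qed

lemma suffix_state_in_rules_states:
  assumes "finite T" "a \<in> bit_words (window_length T)"
  shows "suffix_state T a \<in> rules_states T"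
  using assms window_length_ge[OF assms(1)]
  by (auto simp: suffix_state_def rules_states_def bit_words_def)

text \<open>For the \<open>t\<close> attaining the maximum nothing is dropped, so that component is
  the whole list, whatever its length.\<close>

lemma inj_suffix_state:
  assumes "finite T" "T \<noteq> {}"
  shows "inj (suffix_state T)"
proof (rule injI)
  fix a b assume eq: "suffix_state T a = suffix_state T b"
  obtain t where "t \<in> T" "t - 1 = window_length T"
    using window_length_attained assms .
  with fun_cong[OF eq, of t] show "a = b"
    by (simp add: suffix_state_def)
qed

lemma shift_state_suffix_state:
  assumes "finite T" "\<forall>t\<in>T. 1 < t" "a \<in> bit_words (window_length T)"
  shows "shift_state T e (suffix_state T a) = suffix_state T (shift e a)"
proof
  fix t
  show "shift_state T e (suffix_state T a) t = suffix_state T (shift e a) t"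
  proof (cases "t \<in> T")
    case True
    \<comment> \<open>This bound, due to \<open>1 < t\<close>, keeps the appended letter
      \<open>e\<close> out of the dropped part.\<close>
    then have "window_length T - (t - 1) \<le> length (tl a)"
      using assms by (auto simp: bit_words_def)
    with True show ?thesis
      by (simp add: shift_state_def suffix_state_def shift_def tl_drop)
  qed (simp add: shift_state_def suffix_state_def)
qed

lemma suffix_state_nth_0:
  assumes "finite T" "\<forall>t\<in>T. 1 < t" "a \<in> bit_words (window_length T)" "t \<in> T"
  shows "suffix_state T a t ! 0 = a ! (window_length T + 1 - t)"
proof -
  have "1 < t" "t - 1 \<le> window_length T"
    using assms window_length_ge by auto
  then have "window_length T - (t - 1) = window_length T + 1 - t"
    "window_length T + 1 - t \<le> window_length T"
    by auto
  then show ?thesis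
    using assms by (simp add: suffix_state_def bit_words_def)
qed

text \<open>Injectivity matches the transitions, and the first letters of the components are the
  letters of \<open>a\<close> in the sign. The swapped arguments are the source of the
  transpose.\<close>

lemma rules_transition_suffix_state:
  assumes "finite T" "T \<noteq> {}" "\<forall>t\<in>T. 1 < t" "a \<in> bit_words (window_length T)"
  shows "rules_transition T (suffix_state T b) (suffix_state T a) = signed_de_bruijn T a b"
proof -
  have sums: "(\<Sum>t\<in>T. suffix_state T a t ! 0) = (\<Sum>t\<in>T. a ! (window_length T + 1 - t))"
    using suffix_state_nth_0 assms by (intro sum.cong) auto
  have "suffix_state T b = shift_state T e (suffix_state T a) \<longleftrightarrow> b = shift e a" for e
    using inj_suffix_state[OF assms(1,2)] shift_state_suffix_state[OF assms(1,3,4)]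
    by (simp add: inj_eq)
  then show ?thesis
    by (simp add: rules_transition_def signed_de_bruijn_def sums)
qed

section \<open>Determination of the surviving states\<close>

lemma shift_surj:
  assumes "b \<in> bit_words n" "0 < n"
  obtains a e where "a \<in> bit_words n" "b = shift e a"
proof
  \<comment> \<open>The leading \<open>0\<close> is an arbitrary choice, as \<open>shift\<close>
    discards it.\<close>
  show "0 # butlast b \<in> bit_words n" "b = shift (last b) (0 # butlast b)"
    using assms by (auto simp: bit_words_def shift_def)
qed

text \<open>A nonzero entry in the row of a state lies in the column of a predecessor, so
  \<open>n\<close> inputs can be traced back; \<open>w\<close> lists them, oldest first.\<close>

lemma no_zero_row_history:
  assumes K: "no_zero_row (expanded_rules T) K" "K \<subseteq> expanded_index T"
    and T: "\<forall>t\<in>T. 1 < t"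
    and v: "Some v \<in> K"
  shows "\<exists>u w. Some u \<in> K \<and> length w = n \<and> (\<forall>t\<in>T. v t = drop n (u t @ w))"
  using v
proof (induction n arbitrary: v)
  case 0
  then show ?case
    by (intro exI[of _ v] exI[of _ "[]"]) simp
next
  case (Suc n)
  obtain j where j: "j \<in> K" "expanded_rules T (Some v) j \<noteq> 0"
    using K(1) Suc.prems by (auto simp: no_zero_row_def)
  \<comment> \<open>\<open>j = None\<close> is excluded: the final column vanishes outside the final
    row.\<close>
  then obtain v' where v': "j = Some v'"
    by (cases j) auto
  then obtain e where e: "v = shift_state T e v'"
    using j by (auto simp: rules_transition_def split: if_splits)
  obtain u w where uw: "Some u \<in> K" "length w = n" "\<forall>t\<in>T. v' t = drop n (u t @ w)"
    using Suc.IH[of v'] j v' by blast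
  have "v t = drop (Suc n) (u t @ w @ [e])" if t: "t \<in> T" for t
  proof -
    have "length (u t) = t - 1"
      using uw(1) K(2) t by (auto simp: expanded_index_def rules_states_def bit_words_def)
    \<comment> \<open>With \<open>u t\<close> nonempty, \<open>u t @ w\<close> has more than
      \<open>n\<close> letters, so dropping \<open>Suc n\<close> does not reach
      \<open>e\<close>.\<close>
    then have "u t \<noteq> []"
      using T t by auto
    then have "drop (Suc n) (u t @ w @ [e]) = drop (Suc n) (u t @ w) @ [e]"
      using uw(2) by (cases "u t") auto
    also have "\<dots> = tl (v' t) @ [e]"
      using uw(3) t by (simp only: drop_Suc tl_drop)
    finally show ?thesis
      using t by (simp add: e shift_state_def shift_def)
  qed
  then show ?case
    using uw by (intro exI[of _ u] exI[of _ "w @ [e]"]) simp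
qed

text \<open>A history of length \<open>window_length T\<close> determines a survivor; conversely, no
  deletion can touch a subset that has no zero row of its own.\<close>

lemma rules_index_eq:
  assumes T: "finite T" "T \<noteq> {}" "\<forall>t\<in>T. 1 < t"
  shows "rules_index T = insert None (Some ` suffix_state T ` bit_words (window_length T))"
    (is "_ = ?J")
proof
  let ?M = "window_length T"
  note red = rules_index_reduced[OF T(1)]
  have M_pos: "0 < ?M"
    using T window_length_ge[OF T(1)] by fastforce
  have sub: "rules_index T \<subseteq> expanded_index T"
    using delete_zero_row_subset red(1) .
  show "rules_index T \<subseteq> ?J"
  proof
    fix i assume i: "i \<in> rules_index T"
    show "i \<in> ?J"
    proof (cases i)
      case (Some v)
      obtain u w where uw: "Some u \<in> rules_index T" "length w = ?M"
        "\<forall>t\<in>T. v t = drop ?M (u t @ w)"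
        using no_zero_row_history[OF red(2) sub T(3)] i Some by blast
      have len: "length (u t) = t - 1" if "t \<in> T" for t
        using uw(1) sub that by (auto simp: expanded_index_def rules_states_def bit_words_def)
      have v: "v \<in> rules_states T"
        using i sub Some by (auto simp: expanded_index_def)
      have "v t = suffix_state T w t" for t
      proof (cases "t \<in> T")
        case True
        \<comment> \<open>\<open>u t\<close> has length \<open>t - 1\<close>, at most
          \<open>?M\<close>, so all of it is dropped, together with \<open>?M - (t - 1)\<close>
          letters of \<open>w\<close>.\<close>
        then show ?thesis
          using uw(3) len[OF True] window_length_ge[OF T(1) True] by (simp add: suffix_state_def)
      next
        case False
        \<comment> \<open>Both states are extensional, hence agree outside \<open>T\<close>.\<close>
        with v have "v t = undefined"
          unfolding rules_states_def by (rule PiE_arb)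
        with False show ?thesis
          by (simp add: suffix_state_def)
      qed
      then have "v = suffix_state T w" ..
      then show ?thesis
        using uw(2) Some by (simp add: bit_words_def)
    qed simp
  qed
  have "no_zero_row (expanded_rules T) ?J"
    unfolding no_zero_row_def
  proof
    fix i assume i: "i \<in> ?J"
    show "\<exists>j\<in>?J. expanded_rules T i j \<noteq> 0"
    proof (cases i)
      case None
      \<comment> \<open>The corner entry \<open>2\<close> keeps the final row.\<close>
      then show ?thesis
        by (intro bexI[of _ None]) auto
    next
      case (Some v)
      then obtain b where b: "b \<in> bit_words ?M" "v = suffix_state T b"
        using i by auto
      obtain a e where a: "a \<in> bit_words ?M" "b = shift e a"
        using shift_surj[OF b(1) M_pos] .
      have "expanded_rules T i (Some (suffix_state T a)) \<noteq> 0"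
        using a b Some by (simp add: rules_transition_suffix_state[OF T a(1)] signed_de_bruijn_shift)
      then show ?thesis
        using a by blast
    qed
  qed
  moreover have "?J \<subseteq> expanded_index T"
    using suffix_state_in_rules_states[OF T(1)] by (auto simp: expanded_index_def)
  ultimately show "?J \<subseteq> rules_index T"
    by (rule no_zero_row_subset[OF red(1)])
qed

section \<open>Enumerations and the block form\<close>

lemma permuted_mat_of_enum:
  assumes "mset xs = mset ys"
  obtains p where "p permutes {..<length ys}" "permuted_mat p (mat_of_enum A ys) = mat_of_enum A xs"
proof -
  obtain p where p: "p permutes {..<length ys}" "permute_list p ys = xs"
    using mset_eq_permutation[OF assms] .
  have "xs ! i = ys ! p i" "p i < length ys" if "i < length ys" for i
    using p permute_list_nth[OF p(1) that] permutes_in_image[OF p(1), of i] that by auto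
  moreover have "length xs = length ys"
    using assms by (rule mset_eq_length)
  ultimately have "permuted_mat p (mat_of_enum A ys) = mat_of_enum A xs"
    by (auto simp: permuted_mat_def mat_of_enum_def)
  with p(1) show thesis
    by (rule that)
qed

lemma mat_of_enum_snoc_suffix_states:
  assumes T: "finite T" "T \<noteq> {}" "\<forall>t\<in>T. 1 < t"
    and ws: "set ws = bit_words (window_length T)"
  shows "mat_of_enum (expanded_rules T) (map (Some \<circ> suffix_state T) ws @ [None])
    = four_block_mat (transpose_mat (de_bruijn_matrix T ws)) (0\<^sub>m (length ws) 1)
        (mat 1 (length ws) (\<lambda>(i, j). expanded_rules T None (Some (suffix_state T (ws ! j)))))
        (mat 1 1 (\<lambda>_. 2))"
proof -
  have "rules_transition T (suffix_state T b) (suffix_state T (ws ! j)) = signed_de_bruijn T (ws ! j) b"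
    if "j < length ws" for b j
    using rules_transition_suffix_state[OF T] ws nth_mem[OF that] by blast
  then show ?thesis
    by (auto simp: mat_of_enum_def de_bruijn_matrix_def nth_append)
qed

theorem theorem3p3:
  fixes T :: "nat set" and M :: nat
    and ws :: "bit list list" and us :: "rules_state option list"
    and B R :: "complex mat"
  assumes "finite T" and "T \<noteq> {}" and "\<forall>t\<in>T. 1 < t"
    and "M = window_length T"
    and "distinct ws" and "set ws = bit_words M"
    and "distinct us" and "set us = rules_index T"
    and "B = de_bruijn_matrix T ws"
    and "R = rules_matrix T us"
  shows "B \<in> carrier_mat (2 ^ M) (2 ^ M) \<and>
         (\<exists>p c. p permutes {..<2 ^ M + 1} \<and> c \<in> carrier_mat 1 (2 ^ M) \<and>
            permuted_mat p R =
              four_block_mat (transpose_mat B) (0\<^sub>m (2 ^ M) 1) c (mat 1 1 (\<lambda>_. 2))) \<and>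
         char_poly R = [:- 2, 1:] * char_poly B \<and>
         2 \<in># proots (char_poly R) \<and>
         size (proots (char_poly R) - {#2#}) = 2 ^ M \<and>
         proots (char_poly R) - {#2#} = eigenvalue_mset B"
proof -
  note T = assms(1-3)
  have len: "length ws = 2 ^ M"
    using distinct_card[OF assms(5)] assms(6) card_bit_words by simp
  have B: "B \<in> carrier_mat (2 ^ M) (2 ^ M)"
    using mat_of_enum_carrier[of "signed_de_bruijn T" ws] by (simp add: assms(9) de_bruijn_matrix_def len)
  \<comment> \<open>An enumeration of \<open>rules_index T\<close> adapted to \<open>ws\<close>,
    with \<open>None\<close> last to match the blocks; \<open>us\<close> is a rearrangement of
    it.\<close>
  define xs where "xs = map (Some \<circ> suffix_state T) ws @ [None]"
  define c where
    "c = mat 1 (length ws) (\<lambda>(i, j). expanded_rules T None (Some (suffix_state T (ws ! j))))"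
  have c: "c \<in> carrier_mat 1 (2 ^ M)"
    by (simp add: c_def len)
  have "inj_on (Some \<circ> suffix_state T) (set ws)"
    using inj_suffix_state[OF T(1,2)] by (auto simp: inj_on_def dest: injD)
  then have "distinct xs"
    using assms(5) by (auto simp: xs_def distinct_map)
  moreover have "set xs = set us"
    by (auto simp: xs_def assms(4,6,8) rules_index_eq[OF T])
  ultimately have mset: "mset xs = mset us"
    using assms(7) set_eq_iff_mset_eq_distinct by blast
  then have len_us: "length us = 2 ^ M + 1"
    using mset_eq_length[OF mset] by (simp add: xs_def len)
  obtain p where p: "p permutes {..<length us}"
    "permuted_mat p (mat_of_enum (expanded_rules T) us) = mat_of_enum (expanded_rules T) xs"
    using permuted_mat_of_enum[OF mset] .
  have block: "permuted_mat p R =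
      four_block_mat (transpose_mat B) (0\<^sub>m (2 ^ M) 1) c (mat 1 1 (\<lambda>_. 2))"
    using p(2) mat_of_enum_snoc_suffix_states[OF T, of ws] assms(4,6)
    by (simp add: assms(9,10) rules_matrix_def xs_def c_def len)
  have R: "R \<in> carrier_mat (length us) (length us)"
    using mat_of_enum_carrier by (simp add: assms(10) rules_matrix_def)
  have two: "char_poly (mat 1 1 (\<lambda>_. 2 :: complex)) = [:- 2, 1:]"
    by (subst char_poly_upper_triangular[of _ 1]) (auto simp: diag_mat_def)
  have "char_poly R = char_poly (transpose_mat B) * char_poly (mat 1 1 (\<lambda>_. 2))"
    unfolding char_poly_permuted_mat[OF R p(1), symmetric] block
    by (rule char_poly_upper_right_zero_col) (use B c in auto)
  then have cp: "char_poly R = [:- 2, 1:] * char_poly B"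
    by (simp only: two char_poly_transpose_mat[OF B] mult.commute)
  have deg: "degree (char_poly B) = 2 ^ M" and "char_poly B \<noteq> 0"
    using degree_monic_char_poly[OF B] by auto
  \<comment> \<open>Removing one \<open>2\<close> thus leaves all of
    \<open>proots (char_poly B)\<close>, even if \<open>2\<close> is also an eigenvalue of
    \<open>B\<close>.\<close>
  then have proots: "proots (char_poly R) = {#2#} + proots (char_poly B)"
    unfolding cp by (subst proots_mult) auto
  show ?thesis
    using B c p(1) block cp proots deg
    by (auto simp: len_us size_proots_complex eigenvalue_mset_eq_proots[OF B])
qed

end
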